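(* Let $K\in\mathcal T$ be such that $K_{i,j}\neq 0$ for all $i,j\in[N]$ with $i\neq j$, and such that for all pairwise distinct $i,j,k,l\in[N]$ and all $\eta_1,\eta_2,\eta_3\in\{-1,0,1\}$, $$\eta_1 K_{i,j}K_{j,k}K_{k,l}K_{l,i}+\eta_2 K_{i,j}K_{j,l}K_{l,k}K_{k,i}+\eta_3 K_{i,k}K_{k,j}K_{j,l}K_{l,i}=0\ \Longrightarrow\ \eta_1=\eta_2=\eta_3=0.$$ Let $H\in\mathcal T$. Then $\det(H_J)=\det(K_J)$ for all nonempty $J\subseteq[N]$ if and only if all of the following hold: (1) $H_{i,i}=K_{i,i}$ for all $i\in[N]$, and $|H_{i,j}|=|K_{i,j}|$ for all $i,j\in[N]$ with $i\neq j$; (2) $H$ has the same signed adjacency graph as $K$, i.e., the adjacency graph of $H$ is, like that of $K$, the complete graph on $[N]$, and $\frac{H_{i,j}}{H_{j,i}}=\frac{K_{i,j}}{K_{j,i}}$ for all $i\neq j$; (3) $\pi_H(J)=\pi_K(J)$ for all $J\subseteq[N]$ of size $3$ or $4$.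
   Context: $[N]=\{1,\dots,N\}$. For an $N\times N$ matrix $M$ and $J\subseteq[N]$, $M_J=(M_{i,j})_{i,j\in J}$. $\mathcal T$ is the set of signed kernels: real $N\times N$ matrices $M$ such that for all $i\neq j$, $M_{j,i}=\epsilon_{i,j}M_{i,j}$ for some $\epsilon_{i,j}=\epsilon_{j,i}\in\{-1,1\}$. The adjacency graph of $M\in\mathcal T$ is the undirected graph on $[N]$ in which $\{i,j\}$ ($i\neq j$) is an edge iff $M_{i,j}\neq 0$; the signed adjacency graph additionally assigns to each edge $\{i,j\}$ the sign $\epsilon_{i,j}=M_{j,i}/M_{i,j}$. For $M\in\mathcal T$ whose adjacency graph is the complete graph, and $J\subseteq[N]$ with $|J|\ge 3$, $$\pi_M(J)=\sum_{\overrightarrow{C}}\ \prod_{(i,j)\in\overrightarrow{C}}M_{i,j},$$ where the sum ranges over all oriented (directed) cycles $\overrightarrow{C}$ of the complete graph whose vertex set is exactly $J$ (equivalently, over all cyclic permutations of $J$ of length $|J|$), each cycle being identified with its set of oriented edges $(i,j)$; the two orientations of the same unoriented cycle are counted separately. *)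

theory Defs
  imports
    Complex_Main
    "Jordan_Normal_Form.Determinant"
    "Jordan_Normal_Form.DL_Submatrix"
begin

(* Matrices are 0-indexed, so the index set [N] is rendered as {..<N}. *)

definition signed_kernels :: "nat \<Rightarrow> real mat set" where
  "signed_kernels N =
     {M \<in> carrier_mat N N.
        \<exists>\<epsilon> :: nat \<Rightarrow> nat \<Rightarrow> real. \<forall>i<N. \<forall>j<N. i \<noteq> j \<longrightarrow>
          \<epsilon> i j \<in> {-1, 1} \<and> \<epsilon> i j = \<epsilon> j i \<and> M $$ (j, i) = \<epsilon> i j * M $$ (i, j)}"

definition principal_submatrix :: "real mat \<Rightarrow> nat set \<Rightarrow> real mat" where
  "principal_submatrix M J = submatrix M J J"

definition complete_graph :: "nat \<Rightarrow> nat set set" where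
  "complete_graph N = {{i, j} | i j. i < N \<and> j < N \<and> i \<noteq> j}"

(* Graphs on the vertex set {..<dim_row M} are given by their edge sets. *)
definition adjacency_graph :: "real mat \<Rightarrow> nat set set" where
  "adjacency_graph M =
     {{i, j} | i j. i < dim_row M \<and> j < dim_row M \<and> i \<noteq> j \<and> M $$ (i, j) \<noteq> 0}"

(* Edges paired with their sign. For a signed kernel the ratio is 1 or -1 and
   does not depend on the order of i and j, so every edge carries a single sign. *)
definition signed_adjacency_graph :: "real mat \<Rightarrow> (nat set \<times> real) set" where
  "signed_adjacency_graph M =
     {({i, j}, M $$ (j, i) / M $$ (i, j)) | i j.
        i < dim_row M \<and> j < dim_row M \<and> i \<noteq> j \<and> M $$ (i, j) \<noteq> 0}"

(* The list [v1, ..., vm] yields the oriented cycle {(v1,v2), ..., (vm,v1)}.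
   Cycles are edge sets, so rotations of a list give the same cycle, while for
   card J \<ge> 3 the two orientations give different ones. Only meant for card J \<ge> 3. *)
definition oriented_cycles :: "nat set \<Rightarrow> (nat \<times> nat) set set" where
  "oriented_cycles J = {set (zip vs (rotate1 vs)) | vs. distinct vs \<and> set vs = J}"

definition cycle_sum :: "real mat \<Rightarrow> nat set \<Rightarrow> real" where
  "cycle_sum M J = (\<Sum>C\<in>oriented_cycles J. \<Prod>(i, j)\<in>C. M $$ (i, j))"

end

theory Submission
  imports Defs
begin

text \<open>
  If all principal minors of \<open>H\<close> and \<open>K\<close> agree, the minors of order 1 and 2 fix the diagonal and the
  products \<open>H\<^bsub>ij\<^esub> H\<^bsub>ji\<^esub>\<close>, hence the absolute values and the edge signs. Grouping the permutations
  in a determinant by cycle type then isolates the sum over full cycles in the minors of order 3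
  and 4: every other term is already known to agree
  (\<open>entries_and_cycle_sums_eq_if_minors_eq\<close>).

  For the converse write \<open>H\<^bsub>ij\<^esub> = s\<^bsub>ij\<^esub> K\<^bsub>ij\<^esub>\<close> and \<open>K\<^bsub>ji\<^esub> = e\<^bsub>ij\<^esub> K\<^bsub>ij\<^esub>\<close> off the diagonal, with symmetric
  signs \<open>s\<close> and \<open>e\<close>. The two orientations of a cycle cancel if its \<open>e\<close>-sign is negative and
  reinforce each other otherwise, so equal cycle sums on 3 vertices say that every triangle of
  positive \<open>e\<close>-sign has positive \<open>s\<close>-sign. On 4 vertices the difference of the cycle sums is 4 times
  a combination of the three cycle products with coefficients 0 or 1, and genericity
  gives the same conclusion for quadrangles of positive \<open>e\<close>-sign.

  These local conditions have only two solutions: either all triangles have \<open>s\<close>-sign 1, or \<open>s\<close> and \<open>e\<close>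
  agree on all triangles (\<open>triangle_sign_dichotomy\<close>). Indeed two negative triangles with
  a common edge have the same \<open>s\<close>-sign, because their sum is a positive quadrangle, and any two
  negative triangles are joined by a chain of such steps, because the negative triangles form a
  two-graph, i.e. every 4-set contains an even number of them (\<open>two_graph_constant\<close>). A signing of
  a complete graph that is positive on all triangles is a coboundary \<open>t\<^bsub>i\<^esub> t\<^bsub>j\<^esub>\<close>
  (\<open>balanced_signing\<close>). So in the first case \<open>H = D K D\<close>, and in the second case, applied to
  \<open>s e\<close>, \<open>H = D K\<^sup>T D\<close>, where \<open>D\<close> is diagonal with entries 1 and -1. Both operations preserve all
  principal minors, so the cycle sums on larger sets never have to be examined.
\<close>

section \<open>Determinants of small order, by cycle type\<close>

lemma det_2:
  fixes A :: "'a :: comm_ring_1 mat"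
  assumes "A \<in> carrier_mat 2 2"
  shows "det A = A $$ (0,0) * A $$ (1,1) - A $$ (0,1) * A $$ (1,0)"
  using assms
  by (simp add: laplace_expansion_row[of A 2 0] cofactor_def det_single mat_delete_def numeral_eq_Suc)

lemma det_3:
  fixes A :: "'a :: comm_ring_1 mat"
  assumes "A \<in> carrier_mat 3 3"
  shows "det A = (let m = (\<lambda>i j. A $$ (i, j)) in
     m 0 0 * m 1 1 * m 2 2 - m 0 0 * (m 1 2 * m 2 1) - m 1 1 * (m 0 2 * m 2 0) - m 2 2 * (m 0 1 * m 1 0)
     + (m 0 1 * m 1 2 * m 2 0 + m 0 2 * m 2 1 * m 1 0))"
proof -
  have "det A = (\<Sum>j<3. A $$ (0,j) * cofactor A 0 j)"
    using assms by (intro laplace_expansion_row) auto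
  then show ?thesis using assms
    by (simp add: cofactor_def det_2 mat_delete_def Let_def eval_nat_numeral algebra_simps)
qed

text \<open>The Laplace expansion is regrouped by cycle type: the identity, transpositions, double
transpositions, 3-cycles with a fixed point, and 4-cycles. Diagonal entries, products over a pair
of opposite entries, and cycle sums appear as separate factors, so that each group can be compared
between two matrices on its own.\<close>
lemma det_4:
  fixes A :: "'a :: comm_ring_1 mat"
  assumes "A \<in> carrier_mat 4 4"
  shows "det A = (let m = (\<lambda>i j. A $$ (i, j)); c = (\<lambda>i j k. m i j * m j k * m k i + m i k * m k j * m j i) in
     m 0 0 * m 1 1 * m 2 2 * m 3 3
     - m 0 0 * m 1 1 * (m 2 3 * m 3 2) - m 0 0 * m 2 2 * (m 1 3 * m 3 1) - m 0 0 * m 3 3 * (m 1 2 * m 2 1)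
     - m 1 1 * m 2 2 * (m 0 3 * m 3 0) - m 1 1 * m 3 3 * (m 0 2 * m 2 0) - m 2 2 * m 3 3 * (m 0 1 * m 1 0)
     + (m 0 1 * m 1 0) * (m 2 3 * m 3 2) + (m 0 2 * m 2 0) * (m 1 3 * m 3 1) + (m 0 3 * m 3 0) * (m 1 2 * m 2 1)
     + m 0 0 * c 1 2 3 + m 1 1 * c 0 2 3 + m 2 2 * c 0 1 3 + m 3 3 * c 0 1 2
     - (m 0 1 * m 1 2 * m 2 3 * m 3 0 + m 0 3 * m 3 2 * m 2 1 * m 1 0
        + m 0 1 * m 1 3 * m 3 2 * m 2 0 + m 0 2 * m 2 3 * m 3 1 * m 1 0
        + m 0 2 * m 2 1 * m 1 3 * m 3 0 + m 0 3 * m 3 1 * m 1 2 * m 2 0))"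
proof -
  have "det A = (\<Sum>j<4. A $$ (0,j) * cofactor A 0 j)"
    using assms by (intro laplace_expansion_row) auto
  then show ?thesis using assms
    by (simp add: cofactor_def det_3 mat_delete_def Let_def eval_nat_numeral algebra_simps)
qed

section \<open>Oriented cycles on three and four vertices\<close>
lemma zip_rotate1:
  assumes "length xs = length ys"
  shows "zip (rotate1 xs) (rotate1 ys) = rotate1 (zip xs ys)"
  using assms by (cases xs; cases ys) auto

text \<open>A cycle can be read off from any of its vertices. Fixing the first vertex \<open>i\<close> leaves one list for
each cyclic permutation, which makes the cycles on 3 or 4 vertices enumerable.\<close>
lemma oriented_cycles_hd:
  assumes "i \<in> J"
  shows "oriented_cycles J =
    (\<lambda>ws. set (zip (i # ws) (ws @ [i]))) ` {ws. distinct ws \<and> set ws = J - {i}}" (is "?L = ?R")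
proof
  have rot: "set (zip (rotate n vs) (rotate1 (rotate n vs))) = set (zip vs (rotate1 vs))"
    for n and vs :: "nat list"
    by (induction n) (simp_all add: zip_rotate1)
  show "?L \<subseteq> ?R"
  proof
    fix C assume "C \<in> ?L"
    then obtain vs where C: "C = set (zip vs (rotate1 vs))" and d: "distinct vs" and s: "set vs = J"
      by (auto simp: oriented_cycles_def)
    obtain xs ys where vs: "vs = xs @ i # ys" using assms s by (auto dest: split_list)
    have "C = set (zip (i # ys @ xs) ((ys @ xs) @ [i]))"
      using C rot[of "length xs" vs] by (simp add: vs rotate_append)
    moreover have "distinct (ys @ xs)" "set (ys @ xs) = J - {i}" using d s by (auto simp: vs)
    ultimately show "C \<in> ?R" by blast
  qed
  show "?R \<subseteq> ?L"
  proof
    fix C assume "C \<in> ?R"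
    then obtain ws where "distinct ws" "set ws = J - {i}" "C = set (zip (i # ws) (ws @ [i]))" by blast
    then have "C = set (zip (i # ws) (rotate1 (i # ws))) \<and> distinct (i # ws) \<and> set (i # ws) = J"
      using assms by auto
    then show "C \<in> ?L" unfolding oriented_cycles_def by blast
  qed
qed

lemma distinct_lists_2:
  assumes "distinct [j, k]"
  shows "{ws. distinct ws \<and> set ws = {j, k}} = {[j, k], [k, j]}"
proof
  show "{ws. distinct ws \<and> set ws = {j, k}} \<subseteq> {[j, k], [k, j]}"
  proof
    fix ws assume ws: "ws \<in> {ws. distinct ws \<and> set ws = {j, k}}"
    then have "length ws = 2" using distinct_card[of ws] assms by auto
    then obtain a b where "ws = [a, b]" by (auto simp: eval_nat_numeral length_Suc_conv)
    with ws show "ws \<in> {[j, k], [k, j]}" by (auto simp: doubleton_eq_iff)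
  qed
qed (use assms in auto)

lemma distinct_lists_3:
  assumes "distinct [j, k, l]"
  shows "{ws. distinct ws \<and> set ws = {j, k, l}} =
    {[j, k, l], [j, l, k], [k, j, l], [k, l, j], [l, j, k], [l, k, j]}" (is "?L = ?R")
proof
  show "?L \<subseteq> ?R"
  proof
    fix ws assume ws: "ws \<in> ?L"
    then have "length ws = 3" using distinct_card[of ws] assms by auto
    then obtain a b c where abc: "ws = [a, b, c]" by (auto simp: eval_nat_numeral length_Suc_conv)
    with ws have "a \<in> {j,k,l}" "b \<in> {j,k,l}" "c \<in> {j,k,l}" "distinct [a,b,c]" by auto
    then show "ws \<in> ?R" unfolding abc by (elim insertE emptyE) simp_all
  qed
qed (use assms in auto)

lemma cycle_sum_3:
  assumes "distinct [i, j, k]"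
  shows "cycle_sum M {i, j, k} = M $$ (i, j) * M $$ (j, k) * M $$ (k, i) + M $$ (i, k) * M $$ (k, j) * M $$ (j, i)"
proof -
  have "{i, j, k} - {i} = {j, k}" using assms by auto
  with assms have cycles: "oriented_cycles {i, j, k} = {{(i,j),(j,k),(k,i)}, {(i,k),(k,j),(j,i)}}"
    by (simp add: oriented_cycles_hd[of i] distinct_lists_2)
  show ?thesis using assms unfolding cycle_sum_def cycles
    by (simp add: set_eq_subset)
qed

text \<open>The six cycles are listed in three pairs of opposite orientations; for a
signed kernel the products in a pair differ only by the sign of the cycle.\<close>
lemma cycle_sum_4:
  assumes "distinct [i, j, k, l]"
  shows "cycle_sum M {i, j, k, l} =
    M $$ (i, j) * M $$ (j, k) * M $$ (k, l) * M $$ (l, i) + M $$ (i, l) * M $$ (l, k) * M $$ (k, j) * M $$ (j, i)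
    + M $$ (i, j) * M $$ (j, l) * M $$ (l, k) * M $$ (k, i) + M $$ (i, k) * M $$ (k, l) * M $$ (l, j) * M $$ (j, i)
    + M $$ (i, k) * M $$ (k, j) * M $$ (j, l) * M $$ (l, i) + M $$ (i, l) * M $$ (l, j) * M $$ (j, k) * M $$ (k, i)"
proof -
  have "{i, j, k, l} - {i} = {j, k, l}" using assms by auto
  with assms have cycles: "oriented_cycles {i, j, k, l} =
      {{(i,j),(j,k),(k,l),(l,i)}, {(i,j),(j,l),(l,k),(k,i)}, {(i,k),(k,j),(j,l),(l,i)},
       {(i,k),(k,l),(l,j),(j,i)}, {(i,l),(l,j),(j,k),(k,i)}, {(i,l),(l,k),(k,j),(j,i)}}"
    by (simp add: oriented_cycles_hd[of i] distinct_lists_3)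
  show ?thesis using assms unfolding cycle_sum_def cycles
    by (simp add: set_eq_subset)
qed

section \<open>Principal minors\<close>

text \<open>In the term of a permutation \<open>p\<close>, every \<open>t i\<close> occurs twice: once for the row \<open>i\<close> and once for
the column \<open>i = p j\<close>.\<close>
lemma det_sign_conjugate:
  fixes A B :: "real mat"
  assumes A: "A \<in> carrier_mat n n" and B: "B \<in> carrier_mat n n"
    and t: "\<And>i. i < n \<Longrightarrow> t i * t i = 1"
    and AB: "\<And>i j. i < n \<Longrightarrow> j < n \<Longrightarrow> B $$ (i, j) = t i * t j * A $$ (i, j)"
  shows "det B = det A"
proof -
  have "(\<Prod>i = 0..<n. B $$ (i, p i)) = (\<Prod>i = 0..<n. A $$ (i, p i))" if p: "p permutes {0..<n}" for p
  proof -
    have "(\<Prod>i = 0..<n. B $$ (i, p i)) = (\<Prod>i = 0..<n. t i * t (p i) * A $$ (i, p i))"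
      using p by (intro prod.cong refl AB) (auto dest: permutes_in_image)
    also have "\<dots> = (\<Prod>i = 0..<n. t i) * (\<Prod>i = 0..<n. t (p i)) * (\<Prod>i = 0..<n. A $$ (i, p i))"
      by (simp add: prod.distrib)
    also have "(\<Prod>i = 0..<n. t (p i)) = (\<Prod>i = 0..<n. t i)"
      using prod.permute[OF p, of t] by (simp add: o_def)
    also have "(\<Prod>i = 0..<n. t i) * (\<Prod>i = 0..<n. t i) = (\<Prod>i = 0..<n. t i * t i)"
      by (simp add: prod.distrib)
    also have "\<dots> = 1" using t by simp
    finally show ?thesis by simp
  qed
  then show ?thesis unfolding det_def'[OF A] det_def'[OF B] by simp
qed
text \<open>The entries of a submatrix are addressed through an increasing enumeration of \<open>J\<close>. What matters is that
the same bijection serves all matrices, so that their minors can be compared term by term.\<close>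
lemma principal_submatrix_enum:
  assumes "J \<subseteq> {..<N}"
  obtains v where "inj_on v {..<card J}" "v ` {..<card J} = J"
    "\<And>M. M \<in> carrier_mat N N \<Longrightarrow> principal_submatrix M J \<in> carrier_mat (card J) (card J)"
    "\<And>M a b. M \<in> carrier_mat N N \<Longrightarrow> a < card J \<Longrightarrow> b < card J \<Longrightarrow>
       principal_submatrix M J $$ (a, b) = M $$ (v a, v b)"
proof -
  have fin: "finite J" using assms finite_subset by blast
  have J: "{i. i < N \<and> i \<in> J} = J" using assms by auto
  have inj: "inj_on (pick J) {..<card J}"
    using pick_mono_le[of _ J] by (intro linorder_inj_onI) fastforce+
  moreover have "pick J ` {..<card J} = J"
    using inj fin by (intro card_subset_eq) (auto simp: pick_in_set_le card_image)
  ultimately show ?thesis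
    by (intro that[of "pick J"]) (auto simp: principal_submatrix_def submatrix_def J)
qed

lemma det_principal_submatrix_rescale:
  assumes J: "J \<subseteq> {..<N}" and K: "K \<in> carrier_mat N N" and H: "H \<in> carrier_mat N N"
    and t: "\<And>i. t i * t i = 1"
    and HK: "\<And>i j. i < N \<Longrightarrow> j < N \<Longrightarrow> H $$ (i, j) = t i * t j * K $$ (i, j)"
  shows "det (principal_submatrix H J) = det (principal_submatrix K J)"
proof -
  obtain v where v: "v ` {..<card J} = J"
    and c: "\<And>M. M \<in> carrier_mat N N \<Longrightarrow> principal_submatrix M J \<in> carrier_mat (card J) (card J)"
    and e: "\<And>M a b. M \<in> carrier_mat N N \<Longrightarrow> a < card J \<Longrightarrow> b < card J \<Longrightarrow>
       principal_submatrix M J $$ (a, b) = M $$ (v a, v b)"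
    using principal_submatrix_enum[OF J] by metis
  have lt: "v a < N" if "a < card J" for a using v J that by auto
  show ?thesis
    using t lt by (intro det_sign_conjugate[where t = "t \<circ> v", OF c[OF K] c[OF H]]) (simp_all add: e[OF K] e[OF H] HK)
qed

lemma det_principal_submatrix_transpose:
  assumes J: "J \<subseteq> {..<N}" and K: "K \<in> carrier_mat N N"
  shows "det (principal_submatrix (transpose_mat K) J) = det (principal_submatrix K J)"
proof -
  obtain v where v: "v ` {..<card J} = J"
    and c: "\<And>M. M \<in> carrier_mat N N \<Longrightarrow> principal_submatrix M J \<in> carrier_mat (card J) (card J)"
    and e: "\<And>M a b. M \<in> carrier_mat N N \<Longrightarrow> a < card J \<Longrightarrow> b < card J \<Longrightarrow>
       principal_submatrix M J $$ (a, b) = M $$ (v a, v b)"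
    using principal_submatrix_enum[OF J] by metis
  have lt: "v a < N" if "a < card J" for a using v J that by auto
  have K': "transpose_mat K \<in> carrier_mat N N" using K by simp
  have "principal_submatrix (transpose_mat K) J = transpose_mat (principal_submatrix K J)"
  proof (rule eq_matI)
    fix a b assume "a < dim_row (transpose_mat (principal_submatrix K J))"
      "b < dim_col (transpose_mat (principal_submatrix K J))"
    then have ab: "a < card J" "b < card J" using c[OF K] by auto
    then show "principal_submatrix (transpose_mat K) J $$ (a, b) = transpose_mat (principal_submatrix K J) $$ (a, b)"
      using c[OF K] lt K by (simp add: e[OF K'] e[OF K])
  qed (use c[OF K] c[OF K'] in auto)
  then show ?thesis using det_transpose[OF c[OF K]] by simp
qed

lemma det_principal_submatrix_1:
  assumes M: "M \<in> carrier_mat N N" and i: "i < N"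
  shows "det (principal_submatrix M {i}) = M $$ (i, i)"
proof -
  have "{i} \<subseteq> {..<N}" using i by simp
  then obtain v where v: "v ` {..<card {i}} = {i}"
    and c: "principal_submatrix M {i} \<in> carrier_mat (card {i}) (card {i})"
    and e: "\<And>a b. a < card {i} \<Longrightarrow> b < card {i} \<Longrightarrow> principal_submatrix M {i} $$ (a, b) = M $$ (v a, v b)"
    using principal_submatrix_enum[of "{i}" N] M by metis
  have "v 0 = i" using v by auto
  then show ?thesis using det_single[of "principal_submatrix M {i}"] c e[of 0 0] by simp
qed

lemma det_principal_submatrix_2:
  assumes M: "M \<in> carrier_mat N N" and ij: "i < N" "j < N" "i \<noteq> j"
  shows "det (principal_submatrix M {i, j}) = M $$ (i, i) * M $$ (j, j) - M $$ (i, j) * M $$ (j, i)"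
proof -
  let ?J = "{i, j}"
  have two: "card ?J = 2" using ij by simp
  have "?J \<subseteq> {..<N}" using ij by simp
  then obtain v where v: "v ` {..<2} = ?J"
    and c: "principal_submatrix M ?J \<in> carrier_mat 2 2"
    and e: "\<And>a b. a < 2 \<Longrightarrow> b < 2 \<Longrightarrow> principal_submatrix M ?J $$ (a, b) = M $$ (v a, v b)"
    using principal_submatrix_enum[of ?J N] M unfolding two by metis
  have "{v 0, v 1} = {i, j}" using v by (simp add: eval_nat_numeral lessThan_Suc insert_commute)
  then consider "v 0 = i" "v 1 = j" | "v 0 = j" "v 1 = i" by (auto simp: doubleton_eq_iff)
  then show ?thesis
    by cases (simp_all add: det_2[OF c] e mult.commute)
qed

text \<open>The vertices are obtained rather than given, in the order in which the submatrix lists them; this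
avoids treating the permutations of \<open>J\<close> separately. The same order serves all matrices \<open>M\<close>.\<close>
lemma det_principal_submatrix_3:
  assumes J: "J \<subseteq> {..<N}" and card: "card J = 3"
  obtains i j k where "J = {i, j, k}" "distinct [i, j, k]"
    "\<And>M. M \<in> carrier_mat N N \<Longrightarrow> det (principal_submatrix M J) =
      M $$ (i, i) * M $$ (j, j) * M $$ (k, k) - M $$ (i, i) * (M $$ (j, k) * M $$ (k, j))
      - M $$ (j, j) * (M $$ (i, k) * M $$ (k, i)) - M $$ (k, k) * (M $$ (i, j) * M $$ (j, i))
      + cycle_sum M J"
proof -
  obtain v where inj: "inj_on v {..<3}" and v: "v ` {..<3} = J"
    and c: "\<And>M. M \<in> carrier_mat N N \<Longrightarrow> principal_submatrix M J \<in> carrier_mat 3 3"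
    and e: "\<And>M a b. M \<in> carrier_mat N N \<Longrightarrow> a < 3 \<Longrightarrow> b < 3 \<Longrightarrow>
       principal_submatrix M J $$ (a, b) = M $$ (v a, v b)"
    using principal_submatrix_enum[OF J] unfolding card by metis
  obtain i j k where ijk: "v 0 = i" "v 1 = j" "v 2 = k" by blast
  have J': "J = {i, j, k}" using v ijk by (auto simp: eval_nat_numeral lessThan_Suc)
  have d: "distinct [i, j, k]" by (simp add: inj_on_eq_iff[OF inj] flip: ijk)
  have less: "(0::nat) < 3" "(1::nat) < 3" "(2::nat) < 3" by simp_all
  show ?thesis
  proof (rule that[OF J' d])
    fix M :: "real mat" assume M: "M \<in> carrier_mat N N"
    have cycles: "cycle_sum M J = M $$ (i, j) * M $$ (j, k) * M $$ (k, i) + M $$ (i, k) * M $$ (k, j) * M $$ (j, i)"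
      unfolding J' by (rule cycle_sum_3[OF d])
    show "det (principal_submatrix M J) =
      M $$ (i, i) * M $$ (j, j) * M $$ (k, k) - M $$ (i, i) * (M $$ (j, k) * M $$ (k, j))
      - M $$ (j, j) * (M $$ (i, k) * M $$ (k, i)) - M $$ (k, k) * (M $$ (i, j) * M $$ (j, i))
      + cycle_sum M J"
      unfolding cycles det_3[OF c[OF M]] Let_def by (simp only: e[OF M] less ijk)
  qed
qed

lemma det_principal_submatrix_4:
  assumes J: "J \<subseteq> {..<N}" and card: "card J = 4"
  obtains i j k l where "J = {i, j, k, l}" "distinct [i, j, k, l]"
    "\<And>M. M \<in> carrier_mat N N \<Longrightarrow> det (principal_submatrix M J) = (let m = (\<lambda>i j. M $$ (i, j)) in
      m i i * m j j * m k k * m l l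
      - m i i * m j j * (m k l * m l k) - m i i * m k k * (m j l * m l j) - m i i * m l l * (m j k * m k j)
      - m j j * m k k * (m i l * m l i) - m j j * m l l * (m i k * m k i) - m k k * m l l * (m i j * m j i)
      + (m i j * m j i) * (m k l * m l k) + (m i k * m k i) * (m j l * m l j) + (m i l * m l i) * (m j k * m k j)
      + m i i * cycle_sum M {j, k, l} + m j j * cycle_sum M {i, k, l}
      + m k k * cycle_sum M {i, j, l} + m l l * cycle_sum M {i, j, k}
      - cycle_sum M J)"
proof -
  obtain v where inj: "inj_on v {..<4}" and v: "v ` {..<4} = J"
    and c: "\<And>M. M \<in> carrier_mat N N \<Longrightarrow> principal_submatrix M J \<in> carrier_mat 4 4"
    and e: "\<And>M a b. M \<in> carrier_mat N N \<Longrightarrow> a < 4 \<Longrightarrow> b < 4 \<Longrightarrow>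
       principal_submatrix M J $$ (a, b) = M $$ (v a, v b)"
    using principal_submatrix_enum[OF J] unfolding card by metis
  obtain i j k l where ijkl: "v 0 = i" "v 1 = j" "v 2 = k" "v 3 = l" by blast
  have J': "J = {i, j, k, l}" using v ijkl by (auto simp: eval_nat_numeral lessThan_Suc)
  have d: "distinct [i, j, k, l]" by (simp add: inj_on_eq_iff[OF inj] flip: ijkl)
  then have d3: "distinct [j, k, l]" "distinct [i, k, l]" "distinct [i, j, l]" "distinct [i, j, k]"
    by auto
  have less: "(0::nat) < 4" "(1::nat) < 4" "(2::nat) < 4" "(3::nat) < 4" by simp_all
  show ?thesis
  proof (rule that[OF J' d])
    fix M :: "real mat" assume M: "M \<in> carrier_mat N N"
    note cycles = cycle_sum_4[OF d, of M, folded J'] d3[THEN cycle_sum_3, of M]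
    show "det (principal_submatrix M J) = (let m = (\<lambda>i j. M $$ (i, j)) in
      m i i * m j j * m k k * m l l
      - m i i * m j j * (m k l * m l k) - m i i * m k k * (m j l * m l j) - m i i * m l l * (m j k * m k j)
      - m j j * m k k * (m i l * m l i) - m j j * m l l * (m i k * m k i) - m k k * m l l * (m i j * m j i)
      + (m i j * m j i) * (m k l * m l k) + (m i k * m k i) * (m j l * m l j) + (m i l * m l i) * (m j k * m k j)
      + m i i * cycle_sum M {j, k, l} + m j j * cycle_sum M {i, k, l}
      + m k k * cycle_sum M {i, j, l} + m l l * cycle_sum M {i, j, k}
      - cycle_sum M J)"
      unfolding cycles det_4[OF c[OF M]] Let_def by (simp only: e[OF M] less ijkl)
  qed
qed

section \<open>What the minors of order at most four determine\<close>
lemma signed_kernels_entry: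
  assumes "M \<in> signed_kernels N" "i < N" "j < N" "i \<noteq> j"
  shows "M $$ (j, i) = M $$ (i, j) \<or> M $$ (j, i) = - M $$ (i, j)"
proof -
  obtain \<epsilon> :: "nat \<Rightarrow> nat \<Rightarrow> real" where
    "\<forall>i<N. \<forall>j<N. i \<noteq> j \<longrightarrow> \<epsilon> i j \<in> {-1, 1} \<and> \<epsilon> i j = \<epsilon> j i \<and> M $$ (j, i) = \<epsilon> i j * M $$ (i, j)"
    using assms(1) unfolding signed_kernels_def by blast
  then have "\<epsilon> i j \<in> {-1, 1} \<and> M $$ (j, i) = \<epsilon> i j * M $$ (i, j)" using assms(2-4) by blast
  then show ?thesis by auto
qed

lemma signed_kernels_carrier: "M \<in> signed_kernels N \<Longrightarrow> M \<in> carrier_mat N N"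
  unfolding signed_kernels_def by blast

text \<open>The conclusions follow in order of size: in a minor of order \<open>n\<close>, all terms except the sum over the
\<open>n\<close>-cycles are products of quantities that belong to smaller minors.\<close>
lemma entries_and_cycle_sums_eq_if_minors_eq:
  assumes K: "K \<in> carrier_mat N N" and H: "H \<in> carrier_mat N N"
    and minors: "\<forall>J \<subseteq> {..<N}. J \<noteq> {} \<longrightarrow> det (principal_submatrix H J) = det (principal_submatrix K J)"
  shows "\<And>i. i < N \<Longrightarrow> H $$ (i, i) = K $$ (i, i)"
    and "\<And>i j. i < N \<Longrightarrow> j < N \<Longrightarrow> i \<noteq> j \<Longrightarrow> H $$ (i, j) * H $$ (j, i) = K $$ (i, j) * K $$ (j, i)"
    and "\<And>J. J \<subseteq> {..<N} \<Longrightarrow> card J = 3 \<Longrightarrow> cycle_sum H J = cycle_sum K J"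
    and "\<And>J. J \<subseteq> {..<N} \<Longrightarrow> card J = 4 \<Longrightarrow> cycle_sum H J = cycle_sum K J"
proof -
  show diag: "H $$ (i, i) = K $$ (i, i)" if "i < N" for i
    using minors[rule_format, of "{i}"] that
    by (simp add: det_principal_submatrix_1[OF H] det_principal_submatrix_1[OF K])
  show pair: "H $$ (i, j) * H $$ (j, i) = K $$ (i, j) * K $$ (j, i)" if "i < N" "j < N" "i \<noteq> j" for i j
    using minors[rule_format, of "{i, j}"] that
    by (simp add: det_principal_submatrix_2[OF H] det_principal_submatrix_2[OF K] diag)
  show triple: "cycle_sum H J = cycle_sum K J" if J: "J \<subseteq> {..<N}" and card: "card J = 3" for J
  proof -
    obtain i j k where ijk: "J = {i, j, k}" "distinct [i, j, k]"
      and expand: "\<And>M. M \<in> carrier_mat N N \<Longrightarrow> det (principal_submatrix M J) =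
        M $$ (i, i) * M $$ (j, j) * M $$ (k, k) - M $$ (i, i) * (M $$ (j, k) * M $$ (k, j))
        - M $$ (j, j) * (M $$ (i, k) * M $$ (k, i)) - M $$ (k, k) * (M $$ (i, j) * M $$ (j, i))
        + cycle_sum M J"
      by (rule det_principal_submatrix_3[OF J card]) blast
    have lt: "i < N" "j < N" "k < N" using J ijk by auto
    have eqs: "H $$ (i, i) = K $$ (i, i)" "H $$ (j, j) = K $$ (j, j)" "H $$ (k, k) = K $$ (k, k)"
      "H $$ (j, k) * H $$ (k, j) = K $$ (j, k) * K $$ (k, j)"
      "H $$ (i, k) * H $$ (k, i) = K $$ (i, k) * K $$ (k, i)"
      "H $$ (i, j) * H $$ (j, i) = K $$ (i, j) * K $$ (j, i)"
      using ijk(2) by (simp_all add: diag pair lt)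
    have "det (principal_submatrix H J) = det (principal_submatrix K J)"
      using J card by (intro minors[rule_format]) auto
    then show ?thesis unfolding expand[OF H] expand[OF K] eqs by (rule add_left_imp_eq)
  qed
  show "cycle_sum H J = cycle_sum K J" if J: "J \<subseteq> {..<N}" and card: "card J = 4" for J
  proof -
    obtain i j k l where ijkl: "J = {i, j, k, l}" "distinct [i, j, k, l]"
      and expand: "\<And>M. M \<in> carrier_mat N N \<Longrightarrow> det (principal_submatrix M J) = (let m = (\<lambda>i j. M $$ (i, j)) in
        m i i * m j j * m k k * m l l
        - m i i * m j j * (m k l * m l k) - m i i * m k k * (m j l * m l j) - m i i * m l l * (m j k * m k j)
        - m j j * m k k * (m i l * m l i) - m j j * m l l * (m i k * m k i) - m k k * m l l * (m i j * m j i)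
        + (m i j * m j i) * (m k l * m l k) + (m i k * m k i) * (m j l * m l j) + (m i l * m l i) * (m j k * m k j)
        + m i i * cycle_sum M {j, k, l} + m j j * cycle_sum M {i, k, l}
        + m k k * cycle_sum M {i, j, l} + m l l * cycle_sum M {i, j, k}
        - cycle_sum M J)"
      by (rule det_principal_submatrix_4[OF J card]) blast
    have cancel: "y = z" if "x - y = x - z" for x y z :: real using that by simp
    have lt: "i < N" "j < N" "k < N" "l < N" using J ijkl by auto
    have eqs: "H $$ (i, i) = K $$ (i, i)" "H $$ (j, j) = K $$ (j, j)" "H $$ (k, k) = K $$ (k, k)"
      "H $$ (l, l) = K $$ (l, l)"
      "H $$ (k, l) * H $$ (l, k) = K $$ (k, l) * K $$ (l, k)"
      "H $$ (j, l) * H $$ (l, j) = K $$ (j, l) * K $$ (l, j)"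
      "H $$ (j, k) * H $$ (k, j) = K $$ (j, k) * K $$ (k, j)"
      "H $$ (i, l) * H $$ (l, i) = K $$ (i, l) * K $$ (l, i)"
      "H $$ (i, k) * H $$ (k, i) = K $$ (i, k) * K $$ (k, i)"
      "H $$ (i, j) * H $$ (j, i) = K $$ (i, j) * K $$ (j, i)"
      using ijkl(2) by (simp_all add: diag pair lt)
    have triples:
      "cycle_sum H {j, k, l} = cycle_sum K {j, k, l}" "cycle_sum H {i, k, l} = cycle_sum K {i, k, l}"
      "cycle_sum H {i, j, l} = cycle_sum K {i, j, l}" "cycle_sum H {i, j, k} = cycle_sum K {i, j, k}"
      using ijkl(2) lt by (simp_all add: triple)
    have "det (principal_submatrix H J) = det (principal_submatrix K J)"
      using J card by (intro minors[rule_format]) auto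
    then show ?thesis unfolding expand[OF H] expand[OF K] Let_def eqs triples by (rule cancel)
  qed
qed

text \<open>The product of an opposite pair is plus or minus a square, so its sign is the sign of the edge and
its absolute value the square of the entry.\<close>
lemma signed_pair_determined_by_product:
  fixes a b c d :: real
  assumes "b = a \<or> b = - a" "d = c \<or> d = - c" "c \<noteq> 0" "a * b = c * d"
  shows "\<bar>a\<bar> = \<bar>c\<bar>" "a / b = c / d"
proof -
  have "a * a = c * c \<or> a * a = - (c * c)" using assms by auto
  moreover have "0 \<le> a * a" "0 < c * c" using assms(3) by (auto simp: zero_less_mult_iff)
  ultimately have ac: "a * a = c * c" by linarith
  then show "\<bar>a\<bar> = \<bar>c\<bar>" by (auto simp: square_eq_iff)
  have "b * b = d * d" using ac assms(1,2) by auto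
  moreover have "a / b = (a * b) / (b * b)" "c / d = (c * d) / (d * d)" by simp_all
  ultimately show "a / b = c / d" using assms(4) by simp
qed

section \<open>Negative triangles of a signed complete graph\<close>

text \<open>
A function on the triples of a two-graph that does not change along a common pair of vertices is
constant: any two triples of a two-graph are joined by a chain of triples in which
consecutive ones share two vertices. If \<open>abc\<close> is a triple and \<open>d\<close> another vertex, evenness puts
\<open>d\<close> in a triple with two of \<open>a, b, c\<close>. This moves any triple to one containing a prescribed vertex,
so the problem reduces to two triples with a common vertex.\<close>
lemma two_graph_constant:
  fixes neg :: "'a \<Rightarrow> 'a \<Rightarrow> 'a \<Rightarrow> bool" and f :: "'a \<Rightarrow> 'a \<Rightarrow> 'a \<Rightarrow> 'b"
  assumes neg_commute: "\<And>x y z. neg x y z = neg y x z" "\<And>x y z. neg x y z = neg x z y"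
    and f_commute: "\<And>x y z. f x y z = f y x z" "\<And>x y z. f x y z = f x z y"
    and even: "\<And>a b c d. {a, b, c, d} \<subseteq> V \<Longrightarrow> distinct [a, b, c, d] \<Longrightarrow>
      (neg b c d \<longleftrightarrow> neg a c d) \<longleftrightarrow> (neg a b d \<longleftrightarrow> neg a b c)"
    and edge: "\<And>a b c d. {a, b, c, d} \<subseteq> V \<Longrightarrow> distinct [a, b, c, d] \<Longrightarrow>
      neg a b c \<Longrightarrow> neg a b d \<Longrightarrow> f a b c = f a b d"
    and abc: "neg a b c" "distinct [a, b, c]" "{a, b, c} \<subseteq> V"
    and xyz: "neg x y z" "distinct [x, y, z]" "{x, y, z} \<subseteq> V"
  shows "f a b c = f x y z"
proof -
  (* View the triples axy as edges xy of a graph. If bd, cd or ce is an edge, it connects bc with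
     de. Otherwise evenness on abcd and on acde makes bcd and cde triples of the two-graph, and
     the chain is abc, bcd, cde, ade. *)
  have disjoint_links: "f a b c = f a d e"
    if "distinct [a, b, c, d, e]" "{a, b, c, d, e} \<subseteq> V" "neg a b c" "neg a d e" for a b c d e
  proof (cases "neg a b d")
    case True
    have "f a b c = f a b d" using that True by (intro edge) auto
    also have "\<dots> = f a d b" by (rule f_commute)
    also have "\<dots> = f a d e"
      using that True neg_commute(2)[of a b d] by (intro edge) auto
    finally show ?thesis .
  next
    case abd: False
    show ?thesis
    proof (cases "neg a c d")
      case True
      have "f a b c = f a c b" by (rule f_commute)
      also have "\<dots> = f a c d"
        using that True neg_commute(2)[of a b c] by (intro edge) auto
      also have "\<dots> = f a d c" by (rule f_commute)
      also have "\<dots> = f a d e"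
        using that True neg_commute(2)[of a c d] by (intro edge) auto
      finally show ?thesis .
    next
      case acd: False
      show ?thesis
      proof (cases "neg a c e")
        case True
        have "f a b c = f a c b" by (rule f_commute)
        also have "\<dots> = f a c e"
          using that True neg_commute(2)[of a b c] by (intro edge) auto
        also have "\<dots> = f a e c" by (rule f_commute)
        also have "\<dots> = f a e d"
          using that True neg_commute(2)[of a c e] neg_commute(2)[of a d e] by (intro edge) auto
        also have "\<dots> = f a d e" by (rule f_commute)
        finally show ?thesis .
      next
        case ace: False
        have bcd: "neg b c d" using even[of a b c d] that abd acd by auto
        have cde: "neg c d e" using even[of a c d e] that acd ace by auto
        have "f a b c = f b c a" using f_commute by metis
        also have "\<dots> = f b c d"
          using that bcd neg_commute(1)[of b a c] neg_commute(2)[of b a c] by (intro edge) auto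
        also have "\<dots> = f c d b" using f_commute by metis
        also have "\<dots> = f c d e"
          using that cde bcd neg_commute(1)[of c b d] neg_commute(2)[of c b d] by (intro edge) auto
        also have "\<dots> = f d e c" using f_commute by metis
        also have "\<dots> = f d e a"
          using that cde neg_commute(1)[of d c e] neg_commute(2)[of d c e]
            neg_commute(1)[of a d e] neg_commute(2)[of d a e] by (intro edge) auto
        also have "\<dots> = f a d e" using f_commute by metis
        finally show ?thesis .
      qed
    qed
  qed
  have common_vertex: "f a b c = f a d e"
    if T: "distinct [a, b, c]" "distinct [a, d, e]" "{a, b, c, d, e} \<subseteq> V" "neg a b c" "neg a d e"
    for a b c d e
  proof -
    have shared: "f a b c = f a b d"
      if "distinct [a, b, c]" "distinct [a, b, d]" "{a, b, c, d} \<subseteq> V" "neg a b c" "neg a b d" for b c d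
      using that edge[of a b c d] by (cases "c = d") auto
    show ?thesis
    proof (cases "distinct [a, b, c, d, e]")
      case True
      then show ?thesis using T by (intro disjoint_links)
    next
      case False
      then consider "b = d" | "b = e" | "c = d" | "c = e" using T by auto
      then show ?thesis
      proof cases
        case 1
        then show ?thesis using T shared[of b c e] by simp
      next
        case 2
        then show ?thesis using T shared[of b c d] f_commute(2)[of a d b] neg_commute(2)[of a d b] by auto
      next
        case 3
        then show ?thesis using T shared[of c b e] f_commute(2)[of a b c] neg_commute(2)[of a b c] by auto
      next
        case 4
        then show ?thesis using T shared[of c b d] f_commute(2)[of a b c] neg_commute(2)[of a b c]
            f_commute(2)[of a d c] neg_commute(2)[of a d c] by auto
      qed
    qed
  qed
  have through_x: "f p q r = f x y z" if T: "neg p q r" "distinct [p, q, r]" "{p, q, r} \<subseteq> V" "x \<in> {p, q, r}" for p q r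
  proof -
    consider "x = p" | "x = q" | "x = r" using T by auto
    then show ?thesis
    proof cases
      case 1
      then show ?thesis using T xyz common_vertex[of x q r y z] by auto
    next
      case 2
      then show ?thesis using T xyz common_vertex[of x p r y z] neg_commute(1)[of p q r] f_commute(1)[of p q r]
        by auto
    next
      case 3
      have "f p q r = f r p q" "neg p q r = neg r p q" using f_commute neg_commute by metis+
      then show ?thesis using 3 that xyz common_vertex[of x p q y z] by auto
    qed
  qed
  show ?thesis
  proof (cases "x \<in> {a, b, c}")
    case True
    then show ?thesis using abc through_x by blast
  next
    case False
    then have D: "distinct [x, a, b, c]" "{x, a, b, c} \<subseteq> V" using abc xyz by auto
    then consider "neg x a b" | "neg x a c" | "neg x b c" using even[of x a b c] abc by auto
    then show ?thesis
    proof cases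
      case 1
      have "neg a b x" "f x a b = f a b x" using 1 f_commute neg_commute by metis+
      then show ?thesis using edge[of a b c x] through_x[of x a b] abc D 1 by auto
    next
      case 2
      have "neg a c x" "f x a c = f a c x" "neg a c b" "f a b c = f a c b"
        using 2 abc(1) f_commute neg_commute by metis+
      then show ?thesis using edge[of a c b x] through_x[of x a c] abc D 2 by auto
    next
      case 3
      have "neg b c x" "f x b c = f b c x" "neg b c a" "f a b c = f b c a"
        using 3 abc(1) f_commute neg_commute by metis+
      then show ?thesis using edge[of b c a x] through_x[of x b c] abc D 3 by auto
    qed
  qed
qed

text \<open>Signs are symmetric on the whole type, so that the sign of a triangle is symmetric without side
conditions; a set of vertices is singled out only where sign conditions on cycles are imposed.\<close>
definition signing :: "('a \<Rightarrow> 'a \<Rightarrow> real) \<Rightarrow> bool" where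
  "signing s \<longleftrightarrow> (\<forall>i j. s i j \<in> {-1, 1} \<and> s i j = s j i)"

definition triangle_sign :: "('a \<Rightarrow> 'a \<Rightarrow> real) \<Rightarrow> 'a \<Rightarrow> 'a \<Rightarrow> 'a \<Rightarrow> real" where
  "triangle_sign s i j k = s i j * s j k * s k i"

definition quadrangle_sign :: "('a \<Rightarrow> 'a \<Rightarrow> real) \<Rightarrow> 'a \<Rightarrow> 'a \<Rightarrow> 'a \<Rightarrow> 'a \<Rightarrow> real" where
  "quadrangle_sign s i j k l = s i j * s j k * s k l * s l i"

lemma signing_values: "signing s \<Longrightarrow> s i j = 1 \<or> s i j = -1"
  unfolding signing_def by blast

lemma signing_sq: "signing s \<Longrightarrow> s i j * s i j = 1"
  unfolding signing_def by (metis insertE mult_cancel_right1 singletonD square_eq_1_iff)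

lemma signing_commute: "signing s \<Longrightarrow> s i j = s j i"
  unfolding signing_def by blast

lemma triangle_sign_values: "signing s \<Longrightarrow> triangle_sign s i j k = 1 \<or> triangle_sign s i j k = -1"
  using signing_values[of s i j] signing_values[of s j k] signing_values[of s k i]
  by (auto simp: triangle_sign_def)

lemma triangle_sign_commute:
  assumes "signing s"
  shows "triangle_sign s i j k = triangle_sign s j i k" "triangle_sign s i j k = triangle_sign s i k j"
  using signing_commute[OF assms] by (simp_all add: triangle_sign_def mult_ac)

lemma quadrangle_sign_values: "signing s \<Longrightarrow> quadrangle_sign s i j k l = 1 \<or> quadrangle_sign s i j k l = -1"
  using signing_values[of s i j] signing_values[of s j k] signing_values[of s k l] signing_values[of s l i]
  by (auto simp: quadrangle_sign_def)

text \<open>The shared edge \<open>ab\<close> of the triangles \<open>abc\<close> and \<open>abd\<close> is counted twice and cancels.\<close>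
lemma quadrangle_sign_eq_triangles:
  assumes "signing s"
  shows "quadrangle_sign s a c b d = triangle_sign s a b c * triangle_sign s a b d"
proof -
  have "triangle_sign s a b c * triangle_sign s a b d = (s a b * s a b) * quadrangle_sign s a c b d"
    using signing_commute[OF assms] by (simp add: triangle_sign_def quadrangle_sign_def mult_ac)
  then show ?thesis using signing_sq[OF assms] by simp
qed

text \<open>The triangles of negative sign form a two-graph: each edge of a 4-set lies in two of its four
triangles, so the product of the four signs is 1.\<close>
lemma triangle_sign_even:
  assumes "signing s"
  shows "triangle_sign s b c d * triangle_sign s a c d = triangle_sign s a b d * triangle_sign s a b c"
proof -
  have "triangle_sign s c d b * triangle_sign s c d a = quadrangle_sign s c b d a"
    "triangle_sign s a b d * triangle_sign s a b c = quadrangle_sign s a d b c"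
    using quadrangle_sign_eq_triangles[OF assms] by metis+
  moreover have "quadrangle_sign s c b d a = quadrangle_sign s a d b c"
    using signing_commute[OF assms] by (simp add: quadrangle_sign_def mult_ac)
  moreover have "triangle_sign s c d b = triangle_sign s b c d" "triangle_sign s c d a = triangle_sign s a c d"
    by (simp_all add: triangle_sign_def mult_ac)
  ultimately show ?thesis by simp
qed

text \<open>If neither alternative held, some negative triangle would have \<open>s\<close>-sign -1 and another \<open>s\<close>-sign 1.
Two negative triangles with a common edge span a positive quadrangle, so \<open>s\<close> agrees on them and is
constant on the two-graph of negative triangles.\<close>
lemma triangle_sign_dichotomy:
  assumes e: "signing e" and s: "signing s"
    and pos3: "\<And>i j k. {i, j, k} \<subseteq> V \<Longrightarrow> distinct [i, j, k] \<Longrightarrow>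
      triangle_sign e i j k = 1 \<Longrightarrow> triangle_sign s i j k = 1"
    and pos4: "\<And>i j k l. {i, j, k, l} \<subseteq> V \<Longrightarrow> distinct [i, j, k, l] \<Longrightarrow>
      quadrangle_sign e i j k l = 1 \<Longrightarrow> quadrangle_sign s i j k l = 1"
  shows "(\<forall>i j k. {i, j, k} \<subseteq> V \<longrightarrow> distinct [i, j, k] \<longrightarrow> triangle_sign s i j k = 1) \<or>
    (\<forall>i j k. {i, j, k} \<subseteq> V \<longrightarrow> distinct [i, j, k] \<longrightarrow> triangle_sign s i j k = triangle_sign e i j k)"
proof (rule ccontr)
  assume not: "\<not> ?thesis"
  obtain i j k where ijk: "{i, j, k} \<subseteq> V" "distinct [i, j, k]" "triangle_sign s i j k \<noteq> 1"
    using not by blast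
  obtain x y z where xyz: "{x, y, z} \<subseteq> V" "distinct [x, y, z]"
    "triangle_sign s x y z \<noteq> triangle_sign e x y z"
    using not by blast
  have "triangle_sign s i j k = triangle_sign s x y z"
  proof (rule two_graph_constant[where neg = "\<lambda>a b c. triangle_sign e a b c = -1" and V = V])
    show "(triangle_sign e b c d = -1 \<longleftrightarrow> triangle_sign e a c d = -1)
        \<longleftrightarrow> (triangle_sign e a b d = -1 \<longleftrightarrow> triangle_sign e a b c = -1)" for a b c d
      using triangle_sign_even[OF e, of b c d a] triangle_sign_values[OF e, of b c d]
        triangle_sign_values[OF e, of a c d] triangle_sign_values[OF e, of a b d]
        triangle_sign_values[OF e, of a b c] by auto
  next
    fix a b c d
    assume abcd: "{a, b, c, d} \<subseteq> V" "distinct [a, b, c, d]"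
      "triangle_sign e a b c = -1" "triangle_sign e a b d = -1"
    then have "quadrangle_sign e a c b d = 1" by (simp add: quadrangle_sign_eq_triangles[OF e])
    with abcd have "quadrangle_sign s a c b d = 1" by (intro pos4) auto
    then show "triangle_sign s a b c = triangle_sign s a b d"
      using triangle_sign_values[OF s, of a b c] triangle_sign_values[OF s, of a b d]
      by (auto simp: quadrangle_sign_eq_triangles[OF s])
  next
    show "triangle_sign e i j k = -1" "triangle_sign e x y z = -1"
      using ijk xyz pos3 triangle_sign_values[OF e] by metis+
  qed (use ijk xyz triangle_sign_commute[OF e] triangle_sign_commute[OF s] in \<open>metis | simp\<close>)+
  moreover have "triangle_sign s i j k = -1" using ijk triangle_sign_values[OF s] by metis
  moreover have "triangle_sign s x y z = 1"
    using xyz pos3 triangle_sign_values[OF e] triangle_sign_values[OF s] by metis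
  ultimately show False by simp
qed

text \<open>A signing that is positive on triangles is determined by the edges at one vertex \<open>v\<close>: the triangle \<open>vij\<close> expresses the sign of
\<open>ij\<close> through those of \<open>vi\<close> and \<open>vj\<close>.\<close>
lemma balanced_signing:
  assumes s: "signing s"
    and balanced: "\<And>i j k. {i, j, k} \<subseteq> V \<Longrightarrow> distinct [i, j, k] \<Longrightarrow> triangle_sign s i j k = 1"
  obtains t where "\<And>i. t i * t i = 1" "\<And>i j. i \<in> V \<Longrightarrow> j \<in> V \<Longrightarrow> i \<noteq> j \<Longrightarrow> s i j = t i * t j"
proof (cases "V = {}")
  case True
  then show ?thesis using that[of "\<lambda>_. 1"] by simp
next
  case False
  then obtain v where v: "v \<in> V" by blast
  define t where "t i = (if i = v then 1 else s v i)" for i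
  show ?thesis
  proof (rule that[of t])
    show "t i * t i = 1" for i using signing_sq[OF s] by (simp add: t_def)
    fix i j assume ij: "i \<in> V" "j \<in> V" "i \<noteq> j"
    show "s i j = t i * t j"
    proof (cases "i = v \<or> j = v")
      case True
      then show ?thesis using ij signing_commute[OF s] by (auto simp: t_def)
    next
      case False
      then have "s v i * s i j * s j v = 1" using balanced[of v i j] ij v by (auto simp: triangle_sign_def)
      then have "(s v i * s v i) * (s v j * s v j) * s i j = s v i * s v j"
        using signing_commute[OF s, of j v] by (simp add: algebra_simps)
      then show ?thesis using False signing_sq[OF s] by (simp add: t_def)
    qed
  qed
qed

section \<open>From short cycle sums to all principal minors\<close>

text \<open>Here \<open>H = D K D\<close>, where \<open>D\<close> is the diagonal matrix of signs \<open>t\<close> with coboundary \<open>s\<close>.\<close>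
lemma minors_eq_if_balanced:
  assumes K: "K \<in> carrier_mat N N" and H: "H \<in> carrier_mat N N"
    and diag: "\<And>i. i < N \<Longrightarrow> H $$ (i, i) = K $$ (i, i)"
    and s: "signing s"
    and HK: "\<And>i j. i < N \<Longrightarrow> j < N \<Longrightarrow> i \<noteq> j \<Longrightarrow> H $$ (i, j) = s i j * K $$ (i, j)"
    and balanced: "\<And>i j k. {i, j, k} \<subseteq> {..<N} \<Longrightarrow> distinct [i, j, k] \<Longrightarrow> triangle_sign s i j k = 1"
    and J: "J \<subseteq> {..<N}"
  shows "det (principal_submatrix H J) = det (principal_submatrix K J)"
proof -
  obtain t where t: "\<And>i. t i * t i = 1"
    and st: "\<And>i j. i \<in> {..<N} \<Longrightarrow> j \<in> {..<N} \<Longrightarrow> i \<noteq> j \<Longrightarrow> s i j = t i * t j"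
    using balanced_signing[OF s balanced] by metis
  show ?thesis
  proof (rule det_principal_submatrix_rescale[OF J K H t])
    show "H $$ (i, j) = t i * t j * K $$ (i, j)" if "i < N" "j < N" for i j
      using that by (cases "i = j") (simp_all add: diag HK st t)
  qed
qed

text \<open>Relative to the transpose of \<open>K\<close>, the matrix \<open>H\<close> has the signs \<open>s e\<close>, which are positive on every
triangle.\<close>
lemma minors_eq_if_transpose_balanced:
  assumes K: "K \<in> carrier_mat N N" and H: "H \<in> carrier_mat N N"
    and diag: "\<And>i. i < N \<Longrightarrow> H $$ (i, i) = K $$ (i, i)"
    and s: "signing s" and e: "signing e"
    and HK: "\<And>i j. i < N \<Longrightarrow> j < N \<Longrightarrow> i \<noteq> j \<Longrightarrow> H $$ (i, j) = s i j * K $$ (i, j)"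
    and KK: "\<And>i j. i < N \<Longrightarrow> j < N \<Longrightarrow> i \<noteq> j \<Longrightarrow> K $$ (j, i) = e i j * K $$ (i, j)"
    and eq: "\<And>i j k. {i, j, k} \<subseteq> {..<N} \<Longrightarrow> distinct [i, j, k] \<Longrightarrow>
      triangle_sign s i j k = triangle_sign e i j k"
    and J: "J \<subseteq> {..<N}"
  shows "det (principal_submatrix H J) = det (principal_submatrix K J)"
proof -
  define r where "r i j = s i j * e i j" for i j
  have r: "signing r"
    using signing_values[OF s] signing_values[OF e] signing_commute[OF s] signing_commute[OF e]
    unfolding signing_def r_def by (metis insertI1 insertI2 minus_mult_minus mult_1 mult_minus1_right)
  have "det (principal_submatrix H J) = det (principal_submatrix (transpose_mat K) J)"
  proof (rule minors_eq_if_balanced[OF _ H _ r _ _ J])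
    fix i j k assume "{i, j, k} \<subseteq> {..<N}" "distinct [i, j, k]"
    then have "triangle_sign s i j k = triangle_sign e i j k" by (rule eq)
    moreover have "triangle_sign r i j k = triangle_sign s i j k * triangle_sign e i j k"
      by (simp add: triangle_sign_def r_def)
    ultimately show "triangle_sign r i j k = 1"
      using triangle_sign_values[OF e, of i j k] by auto
  next
    fix i j assume ij: "i < N" "j < N" "i \<noteq> j"
    have "r i j * K $$ (j, i) = (e i j * e i j) * (s i j * K $$ (i, j))"
      using KK[OF ij] by (simp add: r_def)
    then show "H $$ (i, j) = r i j * transpose_mat K $$ (i, j)"
      using ij K HK[OF ij] signing_sq[OF e] by simp
  qed (use K diag in auto)
  also have "\<dots> = det (principal_submatrix K J)"
    using J K by (rule det_principal_submatrix_transpose)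
  finally show ?thesis .
qed

text \<open>On a positive triangle the two orientations contribute the same nonzero product, so nothing
cancels and the common sign relating \<open>H\<close> to \<open>K\<close> must be 1.\<close>
lemma triangle_sign_1_if_cycle_sum_eq:
  assumes s: "signing s" and e: "signing e"
    and HK: "\<And>i j. i < N \<Longrightarrow> j < N \<Longrightarrow> i \<noteq> j \<Longrightarrow> H $$ (i, j) = s i j * K $$ (i, j)"
    and KK: "\<And>i j. i < N \<Longrightarrow> j < N \<Longrightarrow> i \<noteq> j \<Longrightarrow> K $$ (j, i) = e i j * K $$ (i, j)"
    and nonzero: "\<And>i j. i < N \<Longrightarrow> j < N \<Longrightarrow> i \<noteq> j \<Longrightarrow> K $$ (i, j) \<noteq> 0"
    and ijk: "{i, j, k} \<subseteq> {..<N}" "distinct [i, j, k]"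
    and eq: "cycle_sum H {i, j, k} = cycle_sum K {i, j, k}"
    and pos: "triangle_sign e i j k = 1"
  shows "triangle_sign s i j k = 1"
proof -
  let ?P = "K $$ (i, j) * K $$ (j, k) * K $$ (k, i)"
  have rev: "K $$ (i, k) * K $$ (k, j) * K $$ (j, i) = triangle_sign e i j k * ?P"
    using ijk KK[of i j] KK[of j k] KK[of k i] by (simp add: triangle_sign_def)
  have "H $$ (i, j) * H $$ (j, k) * H $$ (k, i) = triangle_sign s i j k * ?P"
    using ijk by (simp add: HK triangle_sign_def)
  moreover have "H $$ (i, k) * H $$ (k, j) * H $$ (j, i) =
      triangle_sign s i j k * (K $$ (i, k) * K $$ (k, j) * K $$ (j, i))"
    using ijk signing_commute[OF s, of i k] signing_commute[OF s, of k j] signing_commute[OF s, of j i]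
    by (simp add: HK triangle_sign_def)
  ultimately have "triangle_sign s i j k * ?P = ?P"
    using eq unfolding cycle_sum_3[OF ijk(2)] rev pos by simp
  moreover have "?P \<noteq> 0" using ijk nonzero by auto
  ultimately show ?thesis by simp
qed

text \<open>Genericity enters through the coefficient of the cycle \<open>ijkl\<close>, which may be any of the three
4-cycles on the given set.\<close>
lemma quadrangle_sign_1_if_cycle_sum_eq:
  assumes s: "signing s" and e: "signing e"
    and HK: "\<And>i j. i < N \<Longrightarrow> j < N \<Longrightarrow> i \<noteq> j \<Longrightarrow> H $$ (i, j) = s i j * K $$ (i, j)"
    and KK: "\<And>i j. i < N \<Longrightarrow> j < N \<Longrightarrow> i \<noteq> j \<Longrightarrow> K $$ (j, i) = e i j * K $$ (i, j)"
    and ijkl: "{i, j, k, l} \<subseteq> {..<N}" "distinct [i, j, k, l]"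
    and generic: "\<And>\<eta>\<^sub>1 \<eta>\<^sub>2 \<eta>\<^sub>3 :: real. \<eta>\<^sub>1 \<in> {-1, 0, 1} \<Longrightarrow> \<eta>\<^sub>2 \<in> {-1, 0, 1} \<Longrightarrow> \<eta>\<^sub>3 \<in> {-1, 0, 1} \<Longrightarrow>
      \<eta>\<^sub>1 * K $$ (i, j) * K $$ (j, k) * K $$ (k, l) * K $$ (l, i)
      + \<eta>\<^sub>2 * K $$ (i, j) * K $$ (j, l) * K $$ (l, k) * K $$ (k, i)
      + \<eta>\<^sub>3 * K $$ (i, k) * K $$ (k, j) * K $$ (j, l) * K $$ (l, i) = 0 \<Longrightarrow> \<eta>\<^sub>1 = 0"
    and eq: "cycle_sum H {i, j, k, l} = cycle_sum K {i, j, k, l}"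
    and pos: "quadrangle_sign e i j k l = 1"
  shows "quadrangle_sign s i j k l = 1"
proof -
  (* Both orientations of a 4-cycle together contribute (1 + e-sign) times its product to K, and
     the s-sign times that to H. The difference is 4 eta times the product, with eta = 0 unless the
     e-sign is 1 and the s-sign is -1. *)
  define \<eta> where "\<eta> a b c d = (1 - quadrangle_sign s a b c d) * (1 + quadrangle_sign e a b c d) / 4" for a b c d
  define w where "w M a b c d = M $$ (a, b) * M $$ (b, c) * M $$ (c, d) * M $$ (d, a)"
    for M :: "real mat" and a b c d
  have \<eta>: "\<eta> a b c d \<in> {-1, 0, 1}" for a b c d
    using quadrangle_sign_values[OF s, of a b c d] quadrangle_sign_values[OF e, of a b c d]
    by (auto simp: \<eta>_def)
  have cycle: "w K a b c d + w K a d c b - (w H a b c d + w H a d c b) = 4 * \<eta> a b c d * w K a b c d"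
    if "{a, b, c, d} \<subseteq> {..<N}" "distinct [a, b, c, d]" for a b c d
  proof -
    have 1: "w K a d c b = quadrangle_sign e a b c d * w K a b c d"
      using that KK[of a b] KK[of b c] KK[of c d] KK[of d a] by (simp add: w_def quadrangle_sign_def)
    have 2: "w H a b c d = quadrangle_sign s a b c d * w K a b c d"
      using that by (simp add: w_def HK quadrangle_sign_def)
    have 3: "w H a d c b = quadrangle_sign s a b c d * w K a d c b"
      using that signing_commute[OF s, of a d] signing_commute[OF s, of d c] signing_commute[OF s, of c b]
        signing_commute[OF s, of b a]
      by (simp add: w_def HK quadrangle_sign_def)
    show ?thesis unfolding 2 3 unfolding 1 \<eta>_def by (simp add: algebra_simps)
  qed
  have sum: "cycle_sum M {i, j, k, l} =
    (w M i j k l + w M i l k j) + (w M i j l k + w M i k l j) + (w M i k j l + w M i l j k)" for M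
    unfolding cycle_sum_4[OF ijkl(2)] w_def by linarith
  have "w K i j k l + w K i l k j - (w H i j k l + w H i l k j) = 4 * \<eta> i j k l * w K i j k l"
    "w K i j l k + w K i k l j - (w H i j l k + w H i k l j) = 4 * \<eta> i j l k * w K i j l k"
    "w K i k j l + w K i l j k - (w H i k j l + w H i l j k) = 4 * \<eta> i k j l * w K i k j l"
    using ijkl by (intro cycle; force)+
  then have "\<eta> i j k l * w K i j k l + \<eta> i j l k * w K i j l k + \<eta> i k j l * w K i k j l = 0"
    using eq unfolding sum by linarith
  then have "\<eta> i j k l = 0"
    using generic[OF \<eta>[of i j k l] \<eta>[of i j l k] \<eta>[of i k j l]] by (simp add: w_def mult.assoc)
  then show ?thesis using pos by (simp add: \<eta>_def)
qed

lemma minors_eq_if_short_cycle_sums_eq: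
  assumes K: "K \<in> carrier_mat N N" and H: "H \<in> carrier_mat N N"
    and diag: "\<And>i. i < N \<Longrightarrow> H $$ (i, i) = K $$ (i, i)"
    and s: "signing s" and e: "signing e"
    and HK: "\<And>i j. i < N \<Longrightarrow> j < N \<Longrightarrow> i \<noteq> j \<Longrightarrow> H $$ (i, j) = s i j * K $$ (i, j)"
    and KK: "\<And>i j. i < N \<Longrightarrow> j < N \<Longrightarrow> i \<noteq> j \<Longrightarrow> K $$ (j, i) = e i j * K $$ (i, j)"
    and nonzero: "\<And>i j. i < N \<Longrightarrow> j < N \<Longrightarrow> i \<noteq> j \<Longrightarrow> K $$ (i, j) \<noteq> 0"
    and generic: "\<And>i j k l \<eta>\<^sub>1 \<eta>\<^sub>2 \<eta>\<^sub>3. {i, j, k, l} \<subseteq> {..<N} \<Longrightarrow> distinct [i, j, k, l] \<Longrightarrow>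
      \<eta>\<^sub>1 \<in> {-1, 0, 1} \<Longrightarrow> \<eta>\<^sub>2 \<in> {-1, 0, 1} \<Longrightarrow> \<eta>\<^sub>3 \<in> {-1, 0, 1} \<Longrightarrow>
      \<eta>\<^sub>1 * K $$ (i, j) * K $$ (j, k) * K $$ (k, l) * K $$ (l, i)
      + \<eta>\<^sub>2 * K $$ (i, j) * K $$ (j, l) * K $$ (l, k) * K $$ (k, i)
      + \<eta>\<^sub>3 * K $$ (i, k) * K $$ (k, j) * K $$ (j, l) * K $$ (l, i) = 0 \<Longrightarrow> \<eta>\<^sub>1 = 0"
    and cycles: "\<And>J. J \<subseteq> {..<N} \<Longrightarrow> card J \<in> {3, 4} \<Longrightarrow> cycle_sum H J = cycle_sum K J"
    and J: "J \<subseteq> {..<N}"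
  shows "det (principal_submatrix H J) = det (principal_submatrix K J)"
proof -
  have "(\<forall>i j k. {i, j, k} \<subseteq> {..<N} \<longrightarrow> distinct [i, j, k] \<longrightarrow> triangle_sign s i j k = 1) \<or>
    (\<forall>i j k. {i, j, k} \<subseteq> {..<N} \<longrightarrow> distinct [i, j, k] \<longrightarrow> triangle_sign s i j k = triangle_sign e i j k)"
  proof (rule triangle_sign_dichotomy[OF e s])
    fix i j k assume ijk: "{i, j, k} \<subseteq> {..<N}" "distinct [i, j, k]" "triangle_sign e i j k = 1"
    then have "cycle_sum H {i, j, k} = cycle_sum K {i, j, k}" by (intro cycles) auto
    then show "triangle_sign s i j k = 1"
      by (intro triangle_sign_1_if_cycle_sum_eq[OF s e HK KK nonzero ijk(1,2) _ ijk(3)])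
  next
    fix i j k l assume ijkl: "{i, j, k, l} \<subseteq> {..<N}" "distinct [i, j, k, l]" "quadrangle_sign e i j k l = 1"
    then have "cycle_sum H {i, j, k, l} = cycle_sum K {i, j, k, l}" by (intro cycles) auto
    then show "quadrangle_sign s i j k l = 1"
      by (intro quadrangle_sign_1_if_cycle_sum_eq[OF s e HK KK ijkl(1,2) generic[OF ijkl(1,2)] _ ijkl(3)])
  qed
  then show ?thesis
  proof
    assume "\<forall>i j k. {i, j, k} \<subseteq> {..<N} \<longrightarrow> distinct [i, j, k] \<longrightarrow> triangle_sign s i j k = 1"
    then show ?thesis by (intro minors_eq_if_balanced[OF K H diag s HK _ J]) auto
  next
    assume "\<forall>i j k. {i, j, k} \<subseteq> {..<N} \<longrightarrow> distinct [i, j, k] \<longrightarrow> triangle_sign s i j k = triangle_sign e i j k"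
    then show ?thesis by (intro minors_eq_if_transpose_balanced[OF K H diag s e HK KK _ J]) auto
  qed
qed

theorem theorem2:
  fixes N :: nat and K H :: "real mat"
  assumes K_kernel: "K \<in> signed_kernels N"
    and K_nonzero: "\<forall>i<N. \<forall>j<N. i \<noteq> j \<longrightarrow> K $$ (i, j) \<noteq> 0"
    and K_generic:
      "\<forall>i<N. \<forall>j<N. \<forall>k<N. \<forall>l<N. distinct [i, j, k, l] \<longrightarrow>
         (\<forall>\<eta>\<^sub>1 \<in> {-1, 0, 1::real}. \<forall>\<eta>\<^sub>2 \<in> {-1, 0, 1::real}. \<forall>\<eta>\<^sub>3 \<in> {-1, 0, 1::real}.
            \<eta>\<^sub>1 * K $$ (i, j) * K $$ (j, k) * K $$ (k, l) * K $$ (l, i)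
            + \<eta>\<^sub>2 * K $$ (i, j) * K $$ (j, l) * K $$ (l, k) * K $$ (k, i)
            + \<eta>\<^sub>3 * K $$ (i, k) * K $$ (k, j) * K $$ (j, l) * K $$ (l, i) = 0
            \<longrightarrow> \<eta>\<^sub>1 = 0 \<and> \<eta>\<^sub>2 = 0 \<and> \<eta>\<^sub>3 = 0)"
    and H_kernel: "H \<in> signed_kernels N"
  shows
    "(\<forall>J \<subseteq> {..<N}. J \<noteq> {} \<longrightarrow> det (principal_submatrix H J) = det (principal_submatrix K J))
     \<longleftrightarrow>
     ((\<forall>i<N. H $$ (i, i) = K $$ (i, i))
       \<and> (\<forall>i<N. \<forall>j<N. i \<noteq> j \<longrightarrow> \<bar>H $$ (i, j)\<bar> = \<bar>K $$ (i, j)\<bar>))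
     \<and> (signed_adjacency_graph H = signed_adjacency_graph K
       \<and> adjacency_graph H = complete_graph N
       \<and> (\<forall>i<N. \<forall>j<N. i \<noteq> j \<longrightarrow> H $$ (i, j) / H $$ (j, i) = K $$ (i, j) / K $$ (j, i)))
     \<and> (\<forall>J \<subseteq> {..<N}. card J \<in> {3, 4} \<longrightarrow> cycle_sum H J = cycle_sum K J)"
proof -
  have K: "K \<in> carrier_mat N N" and H: "H \<in> carrier_mat N N"
    using K_kernel H_kernel by (auto intro: signed_kernels_carrier)
  show ?thesis (is "?minors \<longleftrightarrow> ?entries \<and> ?graphs \<and> ?cycles")
  proof
    assume ?minors
    note eqs = entries_and_cycle_sums_eq_if_minors_eq[OF K H \<open>?minors\<close>]
    have pair: "\<bar>H $$ (i, j)\<bar> = \<bar>K $$ (i, j)\<bar>" "H $$ (i, j) / H $$ (j, i) = K $$ (i, j) / K $$ (j, i)"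
      "H $$ (i, j) \<noteq> 0" if ij: "i < N" "j < N" "i \<noteq> j" for i j
    proof -
      note * = signed_kernels_entry[OF H_kernel ij] signed_kernels_entry[OF K_kernel ij]
      have "K $$ (i, j) \<noteq> 0" using K_nonzero ij by blast
      then show "\<bar>H $$ (i, j)\<bar> = \<bar>K $$ (i, j)\<bar>" "H $$ (i, j) / H $$ (j, i) = K $$ (i, j) / K $$ (j, i)"
        using signed_pair_determined_by_product[OF *] eqs(2)[OF ij] by blast+
      then show "H $$ (i, j) \<noteq> 0" using \<open>K $$ (i, j) \<noteq> 0\<close> by auto
    qed
    have dim: "dim_row H = N" "dim_row K = N" using H K by auto
    have "signed_adjacency_graph H = signed_adjacency_graph K"
      unfolding signed_adjacency_graph_def dim
      by (intro Collect_cong ex_cong1) (metis K_nonzero pair(2,3))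
    moreover have "adjacency_graph H = complete_graph N"
      unfolding adjacency_graph_def complete_graph_def dim
      by (intro Collect_cong ex_cong1) (metis pair(3))
    ultimately show "?entries \<and> ?graphs \<and> ?cycles"
      using eqs pair by auto
  next
    assume R: "?entries \<and> ?graphs \<and> ?cycles"
    (* The value 1 off the range makes both functions signings of the whole type. *)
    define s where "s i j = (if i < N \<and> j < N \<and> i \<noteq> j then H $$ (i, j) / K $$ (i, j) else 1)" for i j
    define e where "e i j = (if i < N \<and> j < N \<and> i \<noteq> j then K $$ (j, i) / K $$ (i, j) else 1)" for i j
    have H_nonzero: "H $$ (i, j) \<noteq> 0" if "i < N" "j < N" "i \<noteq> j" for i j
      using R K_nonzero that by (metis abs_eq_0)
    have s: "signing s"
      unfolding signing_def
    proof (intro allI conjI)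
      fix i j
      show "s i j \<in> {-1, 1}"
      proof (cases "i < N \<and> j < N \<and> i \<noteq> j")
        case True
        then have "\<bar>H $$ (i, j)\<bar> = \<bar>K $$ (i, j)\<bar>" "K $$ (i, j) \<noteq> 0" using R K_nonzero by auto
        then show ?thesis using True by (auto simp: s_def abs_eq_iff)
      qed (auto simp: s_def)
      show "s i j = s j i"
      proof (cases "i < N \<and> j < N \<and> i \<noteq> j")
        case True
        then have "H $$ (i, j) / H $$ (j, i) = K $$ (i, j) / K $$ (j, i)" using R by auto
        then show ?thesis using True K_nonzero H_nonzero by (simp add: s_def field_simps)
      qed (auto simp: s_def)
    qed
    have e: "signing e"
      unfolding signing_def
    proof (intro allI conjI)
      fix i j
      have "e i j = 1 \<and> e j i = 1 \<or> e i j = -1 \<and> e j i = -1"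
      proof (cases "i < N \<and> j < N \<and> i \<noteq> j")
        case True
        then show ?thesis using signed_kernels_entry[OF K_kernel, of i j] K_nonzero by (auto simp: e_def)
      qed (auto simp: e_def)
      then show "e i j \<in> {-1, 1}" "e i j = e j i" by auto
    qed
    show ?minors
    proof (intro allI impI)
      fix J assume "J \<subseteq> {..<N}"
      then show "det (principal_submatrix H J) = det (principal_submatrix K J)"
      proof (rule minors_eq_if_short_cycle_sums_eq[OF K H _ s e, rotated -1])
        show "H $$ (i, j) = s i j * K $$ (i, j)" "K $$ (j, i) = e i j * K $$ (i, j)" "K $$ (i, j) \<noteq> 0"
          if "i < N" "j < N" "i \<noteq> j" for i j
          using that K_nonzero by (auto simp: s_def e_def)
        show "H $$ (i, i) = K $$ (i, i)" if "i < N" for i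
          using R that by blast
        show "cycle_sum H J = cycle_sum K J" if "J \<subseteq> {..<N}" "card J \<in> {3, 4}" for J
          using R that by blast
      next
        fix i j k l :: nat and \<eta>\<^sub>1 \<eta>\<^sub>2 \<eta>\<^sub>3 :: real
        assume "{i, j, k, l} \<subseteq> {..<N}" "distinct [i, j, k, l]"
          and *: "\<eta>\<^sub>1 \<in> {-1, 0, 1}" "\<eta>\<^sub>2 \<in> {-1, 0, 1}" "\<eta>\<^sub>3 \<in> {-1, 0, 1}"
          "\<eta>\<^sub>1 * K $$ (i, j) * K $$ (j, k) * K $$ (k, l) * K $$ (l, i)
            + \<eta>\<^sub>2 * K $$ (i, j) * K $$ (j, l) * K $$ (l, k) * K $$ (k, i)
            + \<eta>\<^sub>3 * K $$ (i, k) * K $$ (k, j) * K $$ (j, l) * K $$ (l, i) = 0"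
        then have ijkl: "i < N" "j < N" "k < N" "l < N" "distinct [i, j, k, l]" by auto
        show "\<eta>\<^sub>1 = 0" using K_generic[rule_format, OF ijkl *] by blast
      qed
    qed
  qed
qed

end
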